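(* Endow $\ell_2$ with the Hilbert $L$-norm, i.e. identify $H\ell_2$ with $H\otimes_{hil}\ell_2$ as a normed space. Let $n\in\mathbb{N}$, let $\mathbf{p}^m\in\ell_2$ ($m=1,2,\dots$) be the sequence with $1$ in the $m$-th place and $0$ elsewhere, let $e_1,e_2,\dots$ be an orthonormal system in $H$, and set $$V:=\sum_{k=1}^ne_k(\mathbf{p}^k\otimes\mathbf{p}^k)\in H(\ell_2\otimes\ell_2).$$ Then $\|V\|_{l}=\sqrt{n}$, where $\|\cdot\|_{l}$ is the norm on $H(\ell_2\otimes\ell_2)$ of the $L$-space $\ell_2\otimes_{l}\ell_2$.
   Context: All linear spaces are complex. $H$ is a fixed separable infinite-dimensional Hilbert space, $\mathcal{B}$ is the algebra of bounded operators on $H$ with the operator norm. For a linear space $E$, $HE:=H\otimes E$ (algebraic tensor product), with elementary tensors written $\xi x$; it is a left $\mathcal{B}$-module via $a\cdot(\xi x):=a(\xi)x$. A $PL$-space is a linear space $E$ together with a norm on $HE$ such that $\|a\cdot u\|\le\|a\|\|u\|$ for all $a\in\mathcal{B}$, $u\in HE$. An (orthogonal) projection $P\in\mathcal{B}$ is a support of $u\in HE$ if $P\cdot u=u$. An $L$-space is a $PL$-space $E$ such that $\|u+v\|^2\le\|u\|^2+\|v\|^2$ whenever $u,v\in HE$ have orthogonal supports. $\otimes_{hil}$ denotes the non-completed Hilbert tensor product. Fix a unitary isomorphism $\iota$ from the Hilbert tensor product $H\widehat\otimes_{hil}H$ onto $H$, and put $\xi\diamondsuit\eta:=\iota(\xi\otimes\eta)$.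 For $u\in HE$, $v\in HF$ the element $u\diamondsuit v\in H(E\otimes F)$ is well defined bilinearly by $\xi x\diamondsuit\eta y:=(\xi\diamondsuit\eta)(x\otimes y)$. For $PL$-spaces $E,F$, $E\otimes_{l}F$ is the $L$-space $E\otimes F$ with the norm on $H(E\otimes F)$ $$\|U\|_{l}:=\inf\Big\{\|a\|\Big(\sum_{k=1}^m\|u_k\|^2\|v_k\|^2\Big)^{1/2}\Big\},$$ the infimum being over all representations $U=a\cdot\big(\sum_{k=1}^m u_k\diamondsuit v_k\big)$ with $m\in\mathbb{N}$, $a\in\mathcal{B}$, $u_k\in HE$, $v_k\in HF$, where the $u_k$ have pairwise orthogonal supports. *)

theory Defs
  imports "HOL-Analysis.Analysis" "HOL-Library.Poly_Mapping"
begin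

section \<open>Complex linear spaces and Hilbert spaces\<close>

class complex_vector = ab_group_add +
  fixes scaleC :: "complex \<Rightarrow> 'a \<Rightarrow> 'a"  (infixr "*\<^sub>C" 75)
  assumes scaleC_add_right: "c *\<^sub>C (x + y) = c *\<^sub>C x + c *\<^sub>C y"
    and scaleC_add_left: "(c + d) *\<^sub>C x = c *\<^sub>C x + d *\<^sub>C x"
    and scaleC_scaleC: "c *\<^sub>C (d *\<^sub>C x) = (c * d) *\<^sub>C x"
    and scaleC_one: "1 *\<^sub>C x = x"

lemma vector_space_scaleC: "vector_space (scaleC :: complex \<Rightarrow> 'a \<Rightarrow> 'a::complex_vector)"
  by unfold_locales (simp_all add: scaleC_add_right scaleC_add_left scaleC_scaleC scaleC_one)

lemma scaleC_zero_left [simp]: "0 *\<^sub>C x = 0"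
  using vector_space.scale_eq_0_iff [OF vector_space_scaleC] by blast

lemma scaleC_zero_right [simp]: "c *\<^sub>C 0 = 0"
  using vector_space.scale_eq_0_iff [OF vector_space_scaleC] by blast

instantiation complex :: complex_vector
begin
definition scaleC_complex :: "complex \<Rightarrow> complex \<Rightarrow> complex" where "scaleC_complex c x = c * x"
instance by standard (simp_all add: scaleC_complex_def algebra_simps)
end

text \<open>The inner product is linear in the first argument.\<close>

class complex_inner = complex_vector + real_normed_vector +
  fixes cinner :: "'a \<Rightarrow> 'a \<Rightarrow> complex"
  assumes scaleR_scaleC: "r *\<^sub>R x = complex_of_real r *\<^sub>C x"
    and cinner_add_left: "cinner (x + y) z = cinner x z + cinner y z"
    and cinner_scaleC_left: "cinner (c *\<^sub>C x) y = c * cinner x y"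
    and cinner_commute: "cinner x y = cnj (cinner y x)"
    and cinner_self: "cinner x x = complex_of_real ((norm x)\<^sup>2)"

class complex_hilbert = complex_inner + complete_space

definition clinear :: "('a::complex_vector \<Rightarrow> 'b::complex_vector) \<Rightarrow> bool" where
  "clinear f \<longleftrightarrow> (\<forall>x y. f (x + y) = f x + f y) \<and> (\<forall>c x. f (c *\<^sub>C x) = c *\<^sub>C f x)"

definition cbilinear :: "('a::complex_vector \<Rightarrow> 'b::complex_vector \<Rightarrow> 'c::complex_vector) \<Rightarrow> bool" where
  "cbilinear B \<longleftrightarrow> (\<forall>x. clinear (B x)) \<and> (\<forall>y. clinear (\<lambda>x. B x y))"

definition bounded_clinear :: "('a::complex_inner \<Rightarrow> 'b::complex_inner) \<Rightarrow> bool" where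
  "bounded_clinear a \<longleftrightarrow> clinear a \<and> bounded_linear a"

definition unitary :: "('a::complex_hilbert \<Rightarrow> 'b::complex_hilbert) \<Rightarrow> bool" where
  "unitary f \<longleftrightarrow> clinear f \<and> surj f \<and> (\<forall>x y. cinner (f x) (f y) = cinner x y)"

definition projection :: "('h::complex_hilbert \<Rightarrow> 'h) \<Rightarrow> bool" where
  "projection P \<longleftrightarrow> bounded_clinear P \<and> P \<circ> P = P \<and> (\<forall>x y. cinner (P x) y = cinner x (P y))"

definition orthonormal_seq :: "(nat \<Rightarrow> 'h::complex_inner) \<Rightarrow> bool" where
  "orthonormal_seq e \<longleftrightarrow> (\<forall>i j. cinner (e i) (e j) = (if i = j then 1 else 0))"

definition separable :: "'h::topological_space itself \<Rightarrow> bool" where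
  "separable _ \<longleftrightarrow> (\<exists>D :: 'h set. countable D \<and> closure D = UNIV)"

definition infinite_dimensional :: "'h::complex_vector itself \<Rightarrow> bool" where
  "infinite_dimensional _ \<longleftrightarrow> (\<nexists>B :: 'h set. finite B \<and> module.span scaleC B = UNIV)"


section \<open>The space of square-summable sequences\<close>

typedef ell2 = "{x :: nat \<Rightarrow> complex. summable (\<lambda>i. (cmod (x i))\<^sup>2)}"
  morphisms ell2_nth Ell2
  by (rule exI [of _ "\<lambda>_. 0"]) simp

setup_lifting type_definition_ell2

lemma ell2_summable: "summable (\<lambda>i. (cmod (ell2_nth x i))\<^sup>2)"
  using ell2_nth [of x] by simp

lemma ell2_summable_prod:
  assumes "summable (\<lambda>i. (cmod (x i))\<^sup>2)" "summable (\<lambda>i. (cmod (y i))\<^sup>2)"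
  shows "summable (\<lambda>i. x i * cnj (y i))"
proof (rule summable_comparison_test' [of "\<lambda>i. (cmod (x i))\<^sup>2 + (cmod (y i))\<^sup>2" 0])
  show "summable (\<lambda>i. (cmod (x i))\<^sup>2 + (cmod (y i))\<^sup>2)" by (rule summable_add [OF assms])
  fix i
  have "0 \<le> (cmod (x i) - cmod (y i))\<^sup>2" by simp
  then have "2 * (cmod (x i) * cmod (y i)) \<le> (cmod (x i))\<^sup>2 + (cmod (y i))\<^sup>2"
    by (simp add: power2_diff)
  moreover have "0 \<le> cmod (x i) * cmod (y i)" by simp
  ultimately have "cmod (x i) * cmod (y i) \<le> (cmod (x i))\<^sup>2 + (cmod (y i))\<^sup>2" by linarith
  then show "norm (x i * cnj (y i)) \<le> (cmod (x i))\<^sup>2 + (cmod (y i))\<^sup>2"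
    by (simp add: norm_mult)
qed

lemma ell2_summable_add:
  assumes "summable (\<lambda>i. (cmod (x i))\<^sup>2)" "summable (\<lambda>i. (cmod (y i))\<^sup>2)"
  shows "summable (\<lambda>i. (cmod (x i + y i))\<^sup>2)"
proof (rule summable_comparison_test' [of "\<lambda>i. 2 * ((cmod (x i))\<^sup>2 + (cmod (y i))\<^sup>2)" 0])
  show "summable (\<lambda>i. 2 * ((cmod (x i))\<^sup>2 + (cmod (y i))\<^sup>2))"
    by (intro summable_mult summable_add assms)
  fix i
  have "(cmod (x i + y i))\<^sup>2 \<le> (cmod (x i) + cmod (y i))\<^sup>2"
    by (intro power_mono norm_triangle_ineq) simp
  also have "\<dots> \<le> 2 * ((cmod (x i))\<^sup>2 + (cmod (y i))\<^sup>2)"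
    using zero_le_power2 [of "cmod (x i) - cmod (y i)"] by (simp add: power2_diff power2_sum)
  finally show "norm ((cmod (x i + y i))\<^sup>2) \<le> 2 * ((cmod (x i))\<^sup>2 + (cmod (y i))\<^sup>2)" by simp
qed

instantiation ell2 :: complex_inner
begin

lift_definition zero_ell2 :: ell2 is "\<lambda>_. 0" by simp
lift_definition plus_ell2 :: "ell2 \<Rightarrow> ell2 \<Rightarrow> ell2" is "\<lambda>x y i. x i + y i"
  by (rule ell2_summable_add)
lift_definition uminus_ell2 :: "ell2 \<Rightarrow> ell2" is "\<lambda>x i. - x i" by simp
lift_definition minus_ell2 :: "ell2 \<Rightarrow> ell2 \<Rightarrow> ell2" is "\<lambda>x y i. x i - y i"
  using ell2_summable_add [of _ "\<lambda>i. - _ i"] by simp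
lift_definition scaleC_ell2 :: "complex \<Rightarrow> ell2 \<Rightarrow> ell2" is "\<lambda>c x i. c * x i"
  by (simp add: norm_mult power_mult_distrib summable_mult)
definition scaleR_ell2 :: "real \<Rightarrow> ell2 \<Rightarrow> ell2" where
  "scaleR_ell2 r x = complex_of_real r *\<^sub>C x"
definition cinner_ell2 :: "ell2 \<Rightarrow> ell2 \<Rightarrow> complex" where
  "cinner_ell2 x y = suminf (\<lambda>i. ell2_nth x i * cnj (ell2_nth y i))"
definition norm_ell2 :: "ell2 \<Rightarrow> real" where
  "norm_ell2 x = sqrt (suminf (\<lambda>i. (cmod (ell2_nth x i))\<^sup>2))"
definition sgn_ell2 :: "ell2 \<Rightarrow> ell2" where
  "sgn_ell2 x = inverse (norm x) *\<^sub>R x"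
definition dist_ell2 :: "ell2 \<Rightarrow> ell2 \<Rightarrow> real" where
  "dist_ell2 x y = norm (x - y)"
definition uniformity_ell2 :: "(ell2 \<times> ell2) filter" where
  "uniformity_ell2 = (INF e\<in>{0<..}. principal {(x, y). dist x y < e})"
definition open_ell2 :: "ell2 set \<Rightarrow> bool" where
  "open_ell2 U \<longleftrightarrow> (\<forall>x\<in>U. \<forall>\<^sub>F (x', y) in uniformity. x' = x \<longrightarrow> y \<in> U)"

instance
proof
  fix x y z :: ell2 and c d :: complex and r s :: real
  show "x + y + z = x + (y + z)" by transfer (simp add: add.assoc)
  show "x + y = y + x" by transfer (simp add: add.commute)
  show "0 + x = x" by transfer simp
  show "- x + x = 0" by transfer simp
  show "x - y = x + - y" by transfer simp
  show scr: "c *\<^sub>C (x + y) = c *\<^sub>C x + c *\<^sub>C y" for c and x y :: ell2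
    by transfer (simp add: algebra_simps)
  show scl: "(c + d) *\<^sub>C x = c *\<^sub>C x + d *\<^sub>C x" for c d and x :: ell2
    by transfer (simp add: algebra_simps)
  show scc: "c *\<^sub>C (d *\<^sub>C x) = (c * d) *\<^sub>C x" for c d and x :: ell2
    by transfer (simp add: algebra_simps)
  show sc1: "1 *\<^sub>C x = x" for x :: ell2 by transfer simp
  show "r *\<^sub>R (x + y) = r *\<^sub>R x + r *\<^sub>R y" by (simp add: scaleR_ell2_def scr)
  show "(r + s) *\<^sub>R x = r *\<^sub>R x + s *\<^sub>R x" by (simp add: scaleR_ell2_def scl)
  show "r *\<^sub>R (s *\<^sub>R x) = (r * s) *\<^sub>R x" by (simp add: scaleR_ell2_def scc)
  show "1 *\<^sub>R x = x" by (simp add: scaleR_ell2_def sc1)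
  show "dist x y = norm (x - y)" by (rule dist_ell2_def)
  show "sgn x = inverse (norm x) *\<^sub>R x" by (rule sgn_ell2_def)
  show "uniformity = (INF e\<in>{0<..}. principal {(x::ell2, y). dist x y < e})"
    by (rule uniformity_ell2_def)
  show "open U \<longleftrightarrow> (\<forall>x\<in>U. \<forall>\<^sub>F (x', y) in uniformity. x' = x \<longrightarrow> y \<in> U)" for U :: "ell2 set"
    by (rule open_ell2_def)
  have nth_scaleC: "ell2_nth (c *\<^sub>C x) i = c * ell2_nth x i" for c x i by transfer simp
  have nth_add: "ell2_nth (x + y) i = ell2_nth x i + ell2_nth y i" for x y i by transfer simp
  have "(norm x)\<^sup>2 = suminf (\<lambda>i. (cmod (ell2_nth x i))\<^sup>2)" for x
    by (simp add: norm_ell2_def suminf_nonneg ell2_summable)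
  note norm2 = this
  show "norm x = 0 \<longleftrightarrow> x = 0"
  proof -
    have "norm x = 0 \<longleftrightarrow> (\<forall>i. ell2_nth x i = 0)"
      unfolding norm_ell2_def
      using suminf_eq_zero_iff [OF ell2_summable [of x]] by simp
    also have "\<dots> \<longleftrightarrow> x = 0" by transfer auto
    finally show ?thesis .
  qed
  show "norm (x + y) \<le> norm x + norm y"
  proof -
    have lim: "(\<lambda>n. L2_set (\<lambda>i. cmod (ell2_nth x i)) {..<n}) \<longlonglongrightarrow> norm x" for x
      unfolding L2_set_def norm_ell2_def
      by (intro tendsto_real_sqrt summable_LIMSEQ ell2_summable)
    have "L2_set (\<lambda>i. cmod (ell2_nth (x + y) i)) {..<n}
        \<le> L2_set (\<lambda>i. cmod (ell2_nth x i)) {..<n} + L2_set (\<lambda>i. cmod (ell2_nth y i)) {..<n}" for n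
      by (rule order_trans [OF L2_set_mono L2_set_triangle_ineq])
        (simp_all add: nth_add norm_triangle_ineq)
    then show ?thesis
      by (intro LIMSEQ_le [OF lim tendsto_add [OF lim lim]]) auto
  qed
  show "norm (r *\<^sub>R x) = \<bar>r\<bar> * norm x"
    by (simp add: norm_ell2_def scaleR_ell2_def nth_scaleC norm_mult power_mult_distrib
        suminf_mult ell2_summable real_sqrt_mult)
  show "r *\<^sub>R x = complex_of_real r *\<^sub>C x" by (rule scaleR_ell2_def)
  note summ = ell2_summable_prod [OF ell2_summable ell2_summable]
  show "cinner (x + y) z = cinner x z + cinner y z"
    by (simp add: cinner_ell2_def nth_add distrib_right suminf_add summ)
  show "cinner (c *\<^sub>C x) y = c * cinner x y"
    by (simp add: cinner_ell2_def nth_scaleC mult.assoc suminf_mult summ)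
  show "cinner x y = cnj (cinner y x)"
  proof -
    have "(\<lambda>i. cnj (ell2_nth y i * cnj (ell2_nth x i))) sums cnj (cinner y x)"
      unfolding cinner_ell2_def sums_cnj by (intro summable_sums summ)
    then show ?thesis by (simp add: cinner_ell2_def mult.commute sums_iff)
  qed
  show "cinner x x = complex_of_real ((norm x)\<^sup>2)"
    by (simp add: norm2 cinner_ell2_def suminf_of_real ell2_summable complex_norm_square [symmetric]
        del: of_real_power)
qed

end

text \<open>Places are counted from \<open>0\<close>.\<close>

lift_definition unit_vec :: "nat \<Rightarrow> ell2" is "\<lambda>m i. if i = m then 1 else 0"
proof -
  fix m :: nat
  show "summable (\<lambda>i. (cmod (if i = m then 1 else 0))\<^sup>2)"
    by (rule summable_finite [of "{m}"]) auto
qed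


section \<open>The algebraic tensor product\<close>

text \<open>
  The quotient of the free complex linear space on \<open>'a \<times> 'b\<close> (finitely supported functions)
  by the subspace spanned by the bilinearity relations.
\<close>

definition free_scale :: "complex \<Rightarrow> ('i \<Rightarrow>\<^sub>0 complex) \<Rightarrow> ('i \<Rightarrow>\<^sub>0 complex)" where
  "free_scale c p = Poly_Mapping.map ((*) c) p"

lemma lookup_free_scale [simp]:
  "Poly_Mapping.lookup (free_scale c p) i = c * Poly_Mapping.lookup p i"
  unfolding free_scale_def by transfer (simp add: when_def)

interpretation free: vector_space "free_scale :: complex \<Rightarrow> ('i \<Rightarrow>\<^sub>0 complex) \<Rightarrow> _"
  by unfold_locales (auto intro!: poly_mapping_eqI simp: lookup_add algebra_simps)

abbreviation gen :: "'a \<Rightarrow> 'b \<Rightarrow> ('a \<times> 'b \<Rightarrow>\<^sub>0 complex)" where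
  "gen x y \<equiv> Poly_Mapping.single (x, y) 1"

definition tensor_rels :: "('a::complex_vector \<times> 'b::complex_vector \<Rightarrow>\<^sub>0 complex) set" where
  "tensor_rels =
     {gen (x + x') y - gen x y - gen x' y | x x' y. True} \<union>
     {gen x (y + y') - gen x y - gen x y' | x y y'. True} \<union>
     {gen (c *\<^sub>C x) y - free_scale c (gen x y) | c x y. True} \<union>
     {gen x (c *\<^sub>C y) - free_scale c (gen x y) | c x y. True}"

quotient_type (overloaded) ('a, 'b) tensor =
  "'a::complex_vector \<times> 'b::complex_vector \<Rightarrow>\<^sub>0 complex"
  / "\<lambda>p q. p - q \<in> module.span free_scale tensor_rels"
proof (rule equivpI)
  show "reflp (\<lambda>p q. p - q \<in> free.span tensor_rels)"
    by (simp add: reflp_def free.span_zero)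
  show "symp (\<lambda>p q. p - q \<in> free.span tensor_rels)"
    by (metis (no_types, lifting) free.span_neg minus_diff_eq sympI)
  show "transp (\<lambda>p q. p - q \<in> free.span tensor_rels)"
    by (rule transpI) (metis (no_types, lifting) diff_add_cancel add_diff_eq free.span_add)
qed

instantiation tensor :: (complex_vector, complex_vector) complex_vector
begin

lift_definition zero_tensor :: "('a, 'b) tensor" is 0 .
lift_definition plus_tensor :: "('a, 'b) tensor \<Rightarrow> ('a, 'b) tensor \<Rightarrow> ('a, 'b) tensor" is "(+)"
  by (metis (no_types, lifting) add_diff_add free.span_add)
lift_definition uminus_tensor :: "('a, 'b) tensor \<Rightarrow> ('a, 'b) tensor" is uminus
  by (metis (no_types, lifting) free.span_neg minus_diff_minus)
definition minus_tensor :: "('a, 'b) tensor \<Rightarrow> ('a, 'b) tensor \<Rightarrow> ('a, 'b) tensor" where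
  "minus_tensor u v = u + - v"
lift_definition scaleC_tensor :: "complex \<Rightarrow> ('a, 'b) tensor \<Rightarrow> ('a, 'b) tensor" is free_scale
  by (metis (no_types, lifting) free.scale_right_diff_distrib free.span_scale)

instance
proof
  fix x y z :: "('a, 'b) tensor" and c d :: complex
  show "x + y + z = x + (y + z)" by transfer (simp add: add.assoc free.span_zero)
  show "x + y = y + x" by transfer (simp add: add.commute free.span_zero)
  show "0 + x = x" by transfer (simp add: free.span_zero)
  show "- x + x = 0" by transfer (simp add: free.span_zero)
  show "x - y = x + - y" by (rule minus_tensor_def)
  show "c *\<^sub>C (x + y) = c *\<^sub>C x + c *\<^sub>C y"
    by transfer (simp add: free.scale_right_distrib free.span_zero)
  show "(c + d) *\<^sub>C x = c *\<^sub>C x + d *\<^sub>C x"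
    by transfer (simp add: free.scale_left_distrib free.span_zero)
  show "c *\<^sub>C (d *\<^sub>C x) = (c * d) *\<^sub>C x" by transfer (simp add: free.span_zero)
  show "1 *\<^sub>C x = x" by transfer (simp add: free.span_zero)
qed

end

lift_definition tens :: "'a::complex_vector \<Rightarrow> 'b::complex_vector \<Rightarrow> ('a, 'b) tensor"
  (infixr "\<otimes>" 70) is gen .

lemma tens_bilinear: "cbilinear ((\<otimes>) :: 'a::complex_vector \<Rightarrow> 'b::complex_vector \<Rightarrow> _)"
proof -
  let ?R = "tensor_rels :: ('a \<times> 'b \<Rightarrow>\<^sub>0 complex) set"
  have "gen (x + x') y - (gen x y + gen x' y) \<in> free.span ?R" for x x' y
    unfolding diff_diff_eq [symmetric] by (rule free.span_base) (unfold tensor_rels_def, blast)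
  moreover have "gen x (y + y') - (gen x y + gen x y') \<in> free.span ?R" for x y y'
    unfolding diff_diff_eq [symmetric] by (rule free.span_base) (unfold tensor_rels_def, blast)
  moreover have "gen (c *\<^sub>C x) y - free_scale c (gen x y) \<in> free.span ?R" for c x y
    by (rule free.span_base) (unfold tensor_rels_def, blast)
  moreover have "gen x (c *\<^sub>C y) - free_scale c (gen x y) \<in> free.span ?R" for c x y
    by (rule free.span_base) (unfold tensor_rels_def, blast)
  ultimately show ?thesis
    by (simp only: cbilinear_def clinear_def tens.abs_eq plus_tensor.abs_eq scaleC_tensor.abs_eq
        tensor.abs_eq_iff simp_thms)
qed

lemma tens_add_left: "(x + x') \<otimes> y = x \<otimes> y + x' \<otimes> y"
  and tens_add_right: "x \<otimes> (y + y') = x \<otimes> y + x \<otimes> y'"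
  and tens_scaleC_left: "(c *\<^sub>C x) \<otimes> y = c *\<^sub>C (x \<otimes> y)"
  and tens_scaleC_right: "x \<otimes> (c *\<^sub>C y) = c *\<^sub>C (x \<otimes> y)"
  by (simp_all add: tens_bilinear [unfolded cbilinear_def clinear_def])

text \<open>
  The linear map induced by \<open>B\<close>. Since \<open>rep_tensor\<close> selects a representative, this is meaningful
  only for bilinear \<open>B\<close>; \<open>tensor_lift_tens\<close> and \<open>clinear_tensor_lift\<close> below characterize it then.
\<close>

definition free_lift :: "('a \<Rightarrow> 'b \<Rightarrow> 'c::complex_vector) \<Rightarrow> ('a \<times> 'b \<Rightarrow>\<^sub>0 complex) \<Rightarrow> 'c" where
  "free_lift B p = (\<Sum>i\<in>Poly_Mapping.keys p. Poly_Mapping.lookup p i *\<^sub>C B (fst i) (snd i))"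

definition tensor_lift ::
  "('a::complex_vector \<Rightarrow> 'b::complex_vector \<Rightarrow> 'c::complex_vector) \<Rightarrow> ('a, 'b) tensor \<Rightarrow> 'c" where
  "tensor_lift B u = free_lift B (rep_tensor u)"

lemma free_lift_superset:
  assumes "finite S" "Poly_Mapping.keys p \<subseteq> S"
  shows "free_lift B p = (\<Sum>i\<in>S. Poly_Mapping.lookup p i *\<^sub>C B (fst i) (snd i))"
  unfolding free_lift_def using assms by (intro sum.mono_neutral_left) (auto simp: in_keys_iff)

lemma free_lift_add: "free_lift B (p + q) = free_lift B p + free_lift B q"
  using keys_add [of p q]
  by (simp add: free_lift_superset [of "Poly_Mapping.keys p \<union> Poly_Mapping.keys q"] lookup_add
      scaleC_add_left sum.distrib)

lemma scaleC_sum: "c *\<^sub>C sum f S = (\<Sum>i\<in>S. c *\<^sub>C f i)"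
proof -
  interpret vector_space scaleC by (rule vector_space_scaleC)
  show ?thesis by (rule scale_sum_right)
qed

lemma free_lift_scale: "free_lift B (free_scale c p) = c *\<^sub>C free_lift B p"
proof -
  have "Poly_Mapping.keys (free_scale c p) \<subseteq> Poly_Mapping.keys p" by (auto simp: in_keys_iff)
  then show ?thesis
    by (simp add: free_lift_superset [of "Poly_Mapping.keys p"] scaleC_sum scaleC_scaleC)
qed

lemma free_lift_gen [simp]: "free_lift B (gen x y) = B x y"
  by (simp add: free_lift_def scaleC_one)

lemma free_lift_diff: "free_lift B (p - q) = free_lift B p - free_lift B q"
  using free_lift_add [of B "p - q" q] by (simp add: eq_diff_eq)

lemma free_lift_span:
  assumes "cbilinear B" "p \<in> free.span tensor_rels"
  shows "free_lift B p = 0"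
  using assms(2)
proof (induction rule: free.span_induct_alt)
  case base
  show ?case by (simp add: free_lift_def)
next
  case (step c x y)
  have "free_lift B x = 0"
    using step(1) assms(1)
    by (auto simp: tensor_rels_def free_lift_diff free_lift_scale cbilinear_def clinear_def)
  then show ?case using step by (simp add: free_lift_add free_lift_scale)
qed

lemma tensor_lift_abs:
  assumes "cbilinear B"
  shows "tensor_lift B (abs_tensor p) = free_lift B p"
proof -
  have "rep_tensor (abs_tensor p) - p \<in> free.span tensor_rels"
    by (rule rep_abs_rsp_left [OF Quotient3_tensor]) (simp add: free.span_zero)
  from free_lift_span [OF assms this] show ?thesis
    by (simp add: tensor_lift_def free_lift_diff)
qed

lemma tensor_lift_tens:
  assumes "cbilinear B"
  shows "tensor_lift B (x \<otimes> y) = B x y"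
  using tensor_lift_abs [OF assms, of "gen x y"] by (simp add: tens.abs_eq)

lemma clinear_tensor_lift:
  assumes "cbilinear B"
  shows "clinear (tensor_lift B)"
  unfolding clinear_def
proof (intro conjI allI)
  fix u v :: "('a, 'b) tensor" and c
  obtain p q where "u = abs_tensor p" "v = abs_tensor q"
    using Quotient3_abs_rep [OF Quotient3_tensor, of u] Quotient3_abs_rep [OF Quotient3_tensor, of v]
    by (blast intro: sym)
  then show "tensor_lift B (u + v) = tensor_lift B u + tensor_lift B v"
    "tensor_lift B (c *\<^sub>C u) = c *\<^sub>C tensor_lift B u"
    by (simp_all add: plus_tensor.abs_eq scaleC_tensor.abs_eq tensor_lift_abs assms
        free_lift_add free_lift_scale)
qed

lemma tensor_lift_add_fun:
  "tensor_lift (\<lambda>x y. B x y + C x y) u = tensor_lift B u + tensor_lift C u"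
  unfolding tensor_lift_def free_lift_def
  by (simp add: scaleC_add_right sum.distrib)

lemma tensor_lift_scale_fun:
  "tensor_lift (\<lambda>x y. c *\<^sub>C B x y) u = c *\<^sub>C tensor_lift B u"
  unfolding tensor_lift_def free_lift_def
  by (simp add: scaleC_sum scaleC_scaleC mult.commute)


section \<open>The Hilbert tensor product\<close>

text \<open>The sesquilinear form with \<open>\<langle>x \<otimes> y, x' \<otimes> y'\<rangle> = \<langle>x, x'\<rangle> \<langle>y, y'\<rangle>\<close>. The inner \<open>tensor_lift\<close>
  computes \<open>\<langle>v, x \<otimes> y\<rangle>\<close>, which is linear in \<open>v\<close>.\<close>

definition hil_cinner ::
  "('a::complex_inner, 'b::complex_inner) tensor \<Rightarrow> ('a, 'b) tensor \<Rightarrow> complex" where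
  "hil_cinner u v =
     tensor_lift (\<lambda>x y. cnj (tensor_lift (\<lambda>x' y'. cinner x' x * cinner y' y) v)) u"

lemma hil_cinner_bilinear_aux:
  "cbilinear (\<lambda>x' y'. cinner x' (x::'a::complex_inner) * cinner y' (y::'b::complex_inner))"
  by (auto simp: cbilinear_def clinear_def cinner_add_left cinner_scaleC_left scaleC_complex_def
      algebra_simps)

lemma cinner_add_right: "cinner x (y + z) = cinner x y + cinner x z"
  by (subst (1 2 3) cinner_commute) (simp only: cinner_add_left complex_cnj_add)

lemma cinner_scaleC_right: "cinner x (c *\<^sub>C y) = cnj c * cinner x y"
  by (subst (1 2) cinner_commute) (simp only: cinner_scaleC_left complex_cnj_mult)

lemma hil_cinner_bilinear_aux2:
  fixes v :: "('a::complex_inner, 'b::complex_inner) tensor"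
  shows "cbilinear (\<lambda>x y. cnj (tensor_lift (\<lambda>x' y'. cinner x' x * cinner y' y) v))"
    (is "cbilinear (\<lambda>x y. cnj (?T x y))")
proof -
  have scale: "tensor_lift (\<lambda>x y. c * B x y) v = c * tensor_lift B v"
    for c and B :: "'a \<Rightarrow> 'b \<Rightarrow> complex"
    using tensor_lift_scale_fun [of c B v] by (simp only: scaleC_complex_def)
  have "?T (x + z) y = ?T x y + ?T z y" for x z y
    by (simp only: cinner_add_right distrib_right tensor_lift_add_fun)
  moreover have "?T x (y + z) = ?T x y + ?T x z" for x y z
    by (simp only: cinner_add_right distrib_left tensor_lift_add_fun)
  moreover have "?T (c *\<^sub>C x) y = cnj c * ?T x y" for c x y
    by (simp only: cinner_scaleC_right mult.assoc scale)
  moreover have "?T x (c *\<^sub>C y) = cnj c * ?T x y" for c x y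
    by (simp only: cinner_scaleC_right mult.left_commute [of "cinner _ x" "cnj c"] scale)
  ultimately show ?thesis
    by (simp add: cbilinear_def clinear_def scaleC_complex_def)
qed

lemma hil_cinner_tens: "hil_cinner (x \<otimes> y) (x' \<otimes> y') = cinner x x' * cinner y y'"
proof -
  have "hil_cinner (x \<otimes> y) (x' \<otimes> y')
      = cnj (tensor_lift (\<lambda>x' y'. cinner x' x * cinner y' y) (x' \<otimes> y'))"
    unfolding hil_cinner_def by (rule tensor_lift_tens [OF hil_cinner_bilinear_aux2])
  also have "\<dots> = cnj (cinner x' x * cinner y' y)"
    by (simp only: tensor_lift_tens [OF hil_cinner_bilinear_aux])
  also have "\<dots> = cinner x x' * cinner y y'"
    by (simp only: complex_cnj_mult cinner_commute [of x x'] cinner_commute [of y y'])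
  finally show ?thesis .
qed

lemma hil_cinner_clinear_left: "clinear (\<lambda>u. hil_cinner u v)"
  unfolding hil_cinner_def by (rule clinear_tensor_lift [OF hil_cinner_bilinear_aux2])

definition hil_norm :: "('a::complex_inner, 'b::complex_inner) tensor \<Rightarrow> real" where
  "hil_norm u = sqrt (Re (hil_cinner u u))"

text \<open>\<open>hilbert_completion j\<close>: the Hilbert space \<open>'k\<close> together with \<open>j\<close> is a completion of the
  pre-Hilbert space \<open>('a, 'b) tensor\<close>, that is, a realization of the completed
  Hilbert tensor product.\<close>

definition hilbert_completion ::
  "(('a::complex_hilbert, 'b::complex_hilbert) tensor \<Rightarrow> 'k::complex_hilbert) \<Rightarrow> bool" where
  "hilbert_completion j \<longleftrightarrow> clinear j \<and> (\<forall>u v. cinner (j u) (j v) = hil_cinner u v) \<and>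
     closure (range j) = UNIV"


section \<open>The norm of the tensor product \<open>\<otimes>\<^sub>l\<close>\<close>

definition act :: "('h::complex_hilbert \<Rightarrow> 'h) \<Rightarrow> ('h, 'e::complex_vector) tensor \<Rightarrow> ('h, 'e) tensor" where
  "act a = tensor_lift (\<lambda>\<xi> x. a \<xi> \<otimes> x)"

lemma act_bilinear_aux:
  assumes "clinear a"
  shows "cbilinear (\<lambda>\<xi> x. a \<xi> \<otimes> x)"
  using assms unfolding cbilinear_def clinear_def
  by (simp add: tens_add_left tens_add_right tens_scaleC_left
      tens_scaleC_right)

lemma act_tens: "clinear a \<Longrightarrow> act a (\<xi> \<otimes> x) = a \<xi> \<otimes> x"
  unfolding act_def by (rule tensor_lift_tens [OF act_bilinear_aux])

lemma clinear_act: "clinear a \<Longrightarrow> clinear (act a)"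
  unfolding act_def by (rule clinear_tensor_lift [OF act_bilinear_aux])

definition support :: "('h::complex_hilbert \<Rightarrow> 'h) \<Rightarrow> ('h, 'e::complex_vector) tensor \<Rightarrow> bool" where
  "support P u \<longleftrightarrow> projection P \<and> act P u = u"

text \<open>\<open>d \<xi> \<eta>\<close> is the element \<open>\<iota>(\<xi> \<otimes> \<eta>)\<close> of \<open>H\<close>.\<close>

definition diamond ::
  "('h::complex_hilbert \<Rightarrow> 'h \<Rightarrow> 'h) \<Rightarrow> ('h, 'e::complex_vector) tensor \<Rightarrow>
   ('h, 'f::complex_vector) tensor \<Rightarrow> ('h, ('e, 'f) tensor) tensor" where
  "diamond d u v = tensor_lift (\<lambda>\<xi> x. tensor_lift (\<lambda>\<eta> y. d \<xi> \<eta> \<otimes> (x \<otimes> y)) v) u"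

lemma diamond_bilinear_aux:
  assumes "cbilinear d"
  shows "cbilinear (\<lambda>\<eta> y. d \<xi> \<eta> \<otimes> (x \<otimes> y))"
  using assms unfolding cbilinear_def clinear_def
  by (simp add: tens_add_left tens_add_right tens_scaleC_left
      tens_scaleC_right)

lemma diamond_bilinear_aux2:
  assumes "cbilinear d"
  shows "cbilinear (\<lambda>\<xi> x. tensor_lift (\<lambda>\<eta> y. d \<xi> \<eta> \<otimes> (x \<otimes> y)) v)"
  using assms unfolding cbilinear_def clinear_def
  by (simp add: tens_add_left tens_add_right tens_scaleC_left tens_scaleC_right
      tensor_lift_add_fun tensor_lift_scale_fun)

lemma diamond_tens:
  assumes "cbilinear d"
  shows "diamond d (\<xi> \<otimes> x) (\<eta> \<otimes> y) = d \<xi> \<eta> \<otimes> (x \<otimes> y)"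
  unfolding diamond_def
  by (rule trans [OF tensor_lift_tens [OF diamond_bilinear_aux2 [OF assms]]
        tensor_lift_tens [OF diamond_bilinear_aux [OF assms]]])

lemma diamond_clinear_left:
  assumes "cbilinear d"
  shows "clinear (\<lambda>u. diamond d u v)"
  unfolding diamond_def by (rule clinear_tensor_lift [OF diamond_bilinear_aux2 [OF assms]])

lemma diamond_clinear_right:
  assumes "cbilinear d"
  shows "clinear (diamond d u)"
  unfolding clinear_def diamond_def
  by (simp only: clinear_tensor_lift [OF diamond_bilinear_aux [OF assms], unfolded clinear_def]
      tensor_lift_add_fun tensor_lift_scale_fun simp_thms)

definition pairwise_orthogonal_supports ::
  "nat \<Rightarrow> (nat \<Rightarrow> ('h::complex_hilbert, 'e::complex_vector) tensor) \<Rightarrow> bool" where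
  "pairwise_orthogonal_supports m u \<longleftrightarrow>
     (\<exists>P. (\<forall>k<m. support (P k) (u k)) \<and>
          (\<forall>k<m. \<forall>l<m. k \<noteq> l \<longrightarrow> P k \<circ> P l = (\<lambda>_. 0)))"

text \<open>\<open>N\<close> and \<open>M\<close> are the norms on \<open>HE\<close> and \<open>HF\<close>.\<close>

definition l_norm ::
  "('h::complex_hilbert \<Rightarrow> 'h \<Rightarrow> 'h) \<Rightarrow>
   (('h, 'e::complex_vector) tensor \<Rightarrow> real) \<Rightarrow> (('h, 'f::complex_vector) tensor \<Rightarrow> real) \<Rightarrow>
   ('h, ('e, 'f) tensor) tensor \<Rightarrow> real" where
  "l_norm d N M U = Inf {onorm a * sqrt (\<Sum>k<m. (N (u k))\<^sup>2 * (M (v k))\<^sup>2) | m a u v.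
     bounded_clinear a \<and> pairwise_orthogonal_supports m u \<and>
     U = act a (\<Sum>k<m. diamond d (u k) (v k))}"

end

theory Submission
  imports Defs
begin

text \<open>
  An element \<open>u\<close> of \<open>H \<otimes> \<ell>\<^sub>2\<close> has coordinates \<open>u\<^sub>i \<in> H\<close> with \<open>\<parallel>u\<parallel>\<^sup>2 = \<Sum>\<^sub>i \<parallel>u\<^sub>i\<parallel>\<^sup>2\<close>, and an element \<open>W\<close>
  of \<open>H \<otimes> (\<ell>\<^sub>2 \<otimes> \<ell>\<^sub>2)\<close> has coordinates \<open>W\<^sub>i\<^sub>j \<in> H\<close>. If \<open>W = \<Sum>\<^sub>k u\<^sub>k \<diamond> v\<^sub>k\<close> with orthogonal supports of
  the \<open>u\<^sub>k\<close>, the summands of \<open>W\<^sub>i\<^sub>j = \<Sum>\<^sub>k (u\<^sub>k)\<^sub>i \<diamond> (v\<^sub>k)\<^sub>j\<close> are pairwise orthogonal, so by Pythagoras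
  \<open>\<Sum>\<^sub>i\<^sub>j \<parallel>W\<^sub>i\<^sub>j\<parallel>\<^sup>2 \<le> \<Sum>\<^sub>k \<parallel>u\<^sub>k\<parallel>\<^sup>2 \<parallel>v\<^sub>k\<parallel>\<^sup>2\<close>. An operator \<open>a\<close> acts coordinatewise, and the coordinates of
  \<open>V\<close> satisfy \<open>\<Sum>\<^sub>i\<^sub>j \<parallel>V\<^sub>i\<^sub>j\<parallel>\<^sup>2 = n\<close>; this gives the lower bound. The upper bound comes from the
  representation \<open>V = a \<cdot> \<Sum>\<^sub>k e\<^sub>k p\<^sup>k \<diamond> e\<^sub>0 p\<^sup>k\<close>, where \<open>a\<close> maps \<open>e\<^sub>k \<diamond> e\<^sub>0\<close> to \<open>e\<^sub>k\<close>.
\<close>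

section \<open>Complex-linear maps and inner products\<close>

lemma clinear_zero:
  assumes "clinear f"
  shows "f 0 = 0"
proof -
  have "f (0 *\<^sub>C 0) = 0 *\<^sub>C f 0"
    using assms unfolding clinear_def by blast
  then show ?thesis by simp
qed

lemma clinear_sum: "clinear f \<Longrightarrow> f (sum g S) = (\<Sum>k\<in>S. f (g k))"
  by (induction S rule: infinite_finite_induct) (auto simp: clinear_zero clinear_def)

lemma clinear_cinner_left: "clinear (\<lambda>x. cinner x y)"
  by (simp add: clinear_def cinner_add_left cinner_scaleC_left scaleC_complex_def)

lemma cinner_zero_left [simp]: "cinner 0 y = 0"
  by (rule clinear_zero [OF clinear_cinner_left])

lemma cinner_zero_right [simp]: "cinner x 0 = 0"
  by (metis cinner_commute cinner_zero_left complex_cnj_zero)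

lemma cinner_sum_left: "cinner (sum g S) y = (\<Sum>k\<in>S. cinner (g k) y)"
  by (rule clinear_sum [OF clinear_cinner_left])

lemma cinner_sum_right: "cinner x (sum g S) = (\<Sum>k\<in>S. cinner x (g k))"
  by (subst (1 2) cinner_commute) (simp add: cinner_sum_left)

section \<open>Orthogonality: Pythagoras, Bessel, and operators built from orthonormal
  systems\<close>

lemma norm_sq_eq_Re_cinner: "(norm x)\<^sup>2 = Re (cinner x x)"
  by (simp add: cinner_self del: of_real_power)

lemma orthonormal_seq_norm:
  assumes "orthonormal_seq e"
  shows "norm (e k) = 1"
proof (rule power2_eq_imp_eq)
  show "(norm (e k))\<^sup>2 = 1\<^sup>2"
    using assms by (simp add: norm_sq_eq_Re_cinner orthonormal_seq_def)
qed simp_all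

lemma norm_sq_scaleC: "(norm (c *\<^sub>C x))\<^sup>2 = (cmod c)\<^sup>2 * (norm (x::'a::complex_inner))\<^sup>2"
proof -
  have "cinner (c *\<^sub>C x) (c *\<^sub>C x) = (c * cnj c) * cinner x x"
    by (simp add: cinner_scaleC_left cinner_scaleC_right)
  also have "\<dots> = complex_of_real ((cmod c)\<^sup>2 * (norm x)\<^sup>2)"
    by (simp only: complex_norm_square [symmetric] cinner_self of_real_mult)
  finally show ?thesis by (simp only: norm_sq_eq_Re_cinner Re_complex_of_real)
qed

lemma norm_sq_add_orthogonal:
  fixes p q :: "'a::complex_inner"
  assumes "cinner p q = 0"
  shows "(norm (p + q))\<^sup>2 = (norm p)\<^sup>2 + (norm q)\<^sup>2"
proof -
  have "cinner q p = 0"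
    using assms by (metis cinner_commute complex_cnj_zero)
  with assms have "cinner (p + q) (p + q) = cinner p p + cinner q q"
    by (simp add: cinner_add_left cinner_add_right)
  then show ?thesis by (simp add: norm_sq_eq_Re_cinner)
qed

lemma norm_sq_sum_orthogonal:
  fixes f :: "'i \<Rightarrow> 'a::complex_inner"
  assumes "finite S" "\<And>k l. k \<in> S \<Longrightarrow> l \<in> S \<Longrightarrow> k \<noteq> l \<Longrightarrow> cinner (f k) (f l) = 0"
  shows "(norm (sum f S))\<^sup>2 = (\<Sum>k\<in>S. (norm (f k))\<^sup>2)"
proof -
  have "cinner (sum f S) (sum f S) = (\<Sum>k\<in>S. \<Sum>l\<in>S. cinner (f k) (f l))"
    unfolding cinner_sum_left by (intro sum.cong refl cinner_sum_right)
  also have "\<dots> = (\<Sum>k\<in>S. \<Sum>l\<in>S. if k = l then cinner (f k) (f k) else 0)"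
    using assms(2) by (intro sum.cong refl) auto
  also have "\<dots> = (\<Sum>k\<in>S. cinner (f k) (f k))"
    using assms(1) by simp
  finally show ?thesis by (simp add: norm_sq_eq_Re_cinner)
qed

text \<open>Pythagoras for \<open>x = q + p\<close>, where \<open>p\<close> is the projection of
  \<open>x\<close> onto the span of the first \<open>n\<close> vectors and the remainder
  \<open>q\<close> is orthogonal to each of them.\<close>

lemma Bessel_inequality:
  fixes f :: "nat \<Rightarrow> 'h::complex_inner"
  assumes "orthonormal_seq f"
  shows "(\<Sum>k<n. (cmod (cinner x (f k)))\<^sup>2) \<le> (norm x)\<^sup>2"
proof -
  define p where "p = (\<Sum>k<n. cinner x (f k) *\<^sub>C f k)"
  define q where "q = x - p"
  have f: "cinner (f k) (f l) = (if k = l then 1 else 0)" for k l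
    using assms by (simp add: orthonormal_seq_def)
  note norm_f = orthonormal_seq_norm [OF assms]
  have np: "(norm p)\<^sup>2 = (\<Sum>k<n. (cmod (cinner x (f k)))\<^sup>2)"
    unfolding p_def
    by (subst norm_sq_sum_orthogonal)
      (simp_all add: f cinner_scaleC_left cinner_scaleC_right norm_sq_scaleC norm_f)
  have "cinner p (f l) = cinner x (f l)" if "l < n" for l
  proof -
    have "cinner p (f l) = (\<Sum>k<n. if k = l then cinner x (f k) else 0)"
      unfolding p_def cinner_sum_left by (intro sum.cong) (simp_all add: cinner_scaleC_left f)
    then show ?thesis using that by simp
  qed
  moreover have "cinner x (f l) = cinner q (f l) + cinner p (f l)" for l
    using cinner_add_left [of q p "f l"] by (simp add: q_def)
  ultimately have "cinner q (f l) = 0" if "l < n" for l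
    using that by (metis add_cancel_left_left)
  then have "cinner q p = 0"
    unfolding p_def cinner_sum_right by (simp add: cinner_scaleC_right)
  then have "(norm x)\<^sup>2 = (norm q)\<^sup>2 + (norm p)\<^sup>2"
    using norm_sq_add_orthogonal [of q p] by (simp add: q_def)
  then show ?thesis by (simp add: np [symmetric])
qed

text \<open>Supplies the operator of the upper bound. Expanding along \<open>f\<close> and
  recombining along \<open>e\<close> is a contraction by Bessel. For \<open>n = 0\<close> this
  operator is zero, hence a bound on \<open>onorm a\<close> rather than an equality.\<close>

lemma orthonormal_seq_partial_isometry:
  fixes e :: "nat \<Rightarrow> 'h::complex_inner" and f :: "nat \<Rightarrow> 'g::complex_inner"
  assumes "orthonormal_seq e" "orthonormal_seq f"
  obtains a where "bounded_clinear a" "onorm a \<le> 1" "\<And>k. k < n \<Longrightarrow> a (f k) = e k"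
proof
  define a where "a x = (\<Sum>k<n. cinner x (f k) *\<^sub>C e k)" for x
  have e: "cinner (e k) (e l) = (if k = l then 1 else 0)"
    and f: "cinner (f k) (f l) = (if k = l then 1 else 0)" for k l
    using assms by (simp_all add: orthonormal_seq_def)
  note norm_e = orthonormal_seq_norm [OF assms(1)]
  have lin: "clinear a"
    by (simp add: clinear_def a_def cinner_add_left cinner_scaleC_left scaleC_add_left sum.distrib
        scaleC_sum scaleC_scaleC)
  have "(norm (a x))\<^sup>2 = (\<Sum>k<n. (cmod (cinner x (f k)))\<^sup>2)" for x
    unfolding a_def
    by (subst norm_sq_sum_orthogonal)
      (simp_all add: e cinner_scaleC_left cinner_scaleC_right norm_sq_scaleC norm_e)
  then have "(norm (a x))\<^sup>2 \<le> (norm x)\<^sup>2" for x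
    using Bessel_inequality [OF assms(2), of x n] by simp
  then have bound: "norm (a x) \<le> norm x * 1" for x
    by (auto intro: power2_le_imp_le)
  have "bounded_linear a"
    by (rule bounded_linear_intro [OF _ _ bound])
      (use lin in \<open>simp_all add: clinear_def scaleR_scaleC\<close>)
  with lin show "bounded_clinear a" by (simp add: bounded_clinear_def)
  show "onorm a \<le> 1"
    using bound by (intro onorm_bound) (simp_all add: mult.commute)
  show "a (f k) = e k" if "k < n" for k
  proof -
    have "a (f k) = (\<Sum>l<n. if l = k then e l else 0)"
      unfolding a_def by (intro sum.cong) (simp_all add: f scaleC_one)
    then show ?thesis using that by simp
  qed
qed

text \<open>These projections onto lines serve as supports of tensors \<open>e \<otimes> x\<close>.
  Boundedness comes from Pythagoras, since self-adjointness and idempotence make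
  \<open>x - P x\<close> orthogonal to \<open>P x\<close>.\<close>

lemma projection_rank_one:
  fixes e :: "'h::complex_hilbert"
  assumes "norm e = 1"
  shows "projection (\<lambda>x. cinner x e *\<^sub>C e)"
  unfolding projection_def
proof (intro conjI allI)
  let ?P = "\<lambda>x. cinner x e *\<^sub>C e"
  have lin: "clinear ?P"
    by (simp add: clinear_def cinner_add_left cinner_scaleC_left scaleC_add_left scaleC_scaleC)
  have sym: "cinner (?P x) y = cinner x (?P y)" for x y
    by (simp add: cinner_scaleC_left cinner_scaleC_right cinner_commute [of e y])
  have ee: "cinner e e = 1" using assms by (simp add: cinner_self)
  show idem: "?P \<circ> ?P = ?P"
    by (simp add: fun_eq_iff cinner_scaleC_left ee)
  have "(norm (?P x))\<^sup>2 \<le> (norm x)\<^sup>2" for x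
  proof -
    let ?p = "?P x" and ?q = "x - ?P x"
    have "cinner ?p ?p = cinner x ?p"
      using sym [of x ?p] idem by (simp add: fun_eq_iff)
    then have "cinner ?q ?p = 0"
      using cinner_add_left [of ?q ?p ?p] by simp
    then have "(norm (?q + ?p))\<^sup>2 = (norm ?q)\<^sup>2 + (norm ?p)\<^sup>2"
      by (rule norm_sq_add_orthogonal)
    then show ?thesis by simp
  qed
  then have bound: "norm (?P x) \<le> norm x * 1" for x
    by (auto intro: power2_le_imp_le)
  have "bounded_linear ?P"
    by (rule bounded_linear_intro [OF _ _ bound])
      (use lin in \<open>simp_all add: clinear_def scaleR_scaleC\<close>)
  with lin show "bounded_clinear ?P" by (simp add: bounded_clinear_def)
  show "cinner (?P x) y = cinner x (?P y)" for x y by (rule sym)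
qed

section \<open>Induction over tensors\<close>

lemma tensor_induct [case_names tens add]:
  assumes tens: "\<And>x y. P (x \<otimes> y)" and add: "\<And>u v. P u \<Longrightarrow> P v \<Longrightarrow> P (u + v)"
  shows "P u"
proof -
  obtain p where u: "u = abs_tensor p"
    using Quotient3_abs_rep [OF Quotient3_tensor, of u] by (blast intro: sym)
  have "P (abs_tensor p)"
  proof (induction p rule: update_induct)
    case const
    \<comment> \<open>The empty sum is itself an elementary tensor.\<close>
    have "(0 :: 'a) \<otimes> (0 :: 'b) = 0"
      using tens_scaleC_left [of 0 "0 :: 'a" "0 :: 'b"] by simp
    then show ?case using tens [of 0 0] by (simp add: zero_tensor_def)
  next
    case (update p i c)
    \<comment> \<open>The induction adds one fresh key at a time: \<open>i\<close> is not a key of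
      \<open>p\<close>, so the update is an addition.\<close>
    have "Poly_Mapping.update i c p = p + free_scale c (gen (fst i) (snd i))"
      using update by (intro poly_mapping_eqI)
        (auto simp: lookup_update lookup_add lookup_single in_keys_iff when_def)
    then have "abs_tensor (Poly_Mapping.update i c p) = abs_tensor p + c *\<^sub>C (fst i \<otimes> snd i)"
      by (simp only: tens.abs_eq plus_tensor.abs_eq scaleC_tensor.abs_eq)
    \<comment> \<open>The scalar \<open>c\<close> is absorbed into the left factor, so the added
      term is again elementary.\<close>
    then show ?case
      using add [OF update(3) tens] by (simp only: tens_scaleC_left [symmetric])
  qed
  then show ?thesis by (simp add: u)
qed

lemma clinear_tensor_eqI:
  assumes "clinear f" "clinear g" "\<And>x y. f (x \<otimes> y) = g (x \<otimes> y)"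
  shows "f u = g u"
  using assms by (induction u rule: tensor_induct) (simp_all add: clinear_def)

section \<open>Coordinates of tensors over \<open>ell2\<close>\<close>

definition coord :: "nat \<Rightarrow> ('h::complex_vector, ell2) tensor \<Rightarrow> 'h" where
  "coord i = tensor_lift (\<lambda>\<xi> x. ell2_nth x i *\<^sub>C \<xi>)"

text \<open>The identity on the first factor tensored with the functional on
  \<open>ell2 \<otimes> ell2\<close> that sends \<open>x \<otimes> y\<close> to the product of the
  \<open>i\<close>-th entry of \<open>x\<close> and the \<open>j\<close>-th entry of
  \<open>y\<close>.\<close>

definition coord2 :: "nat \<Rightarrow> nat \<Rightarrow> ('h::complex_vector, (ell2, ell2) tensor) tensor \<Rightarrow> 'h" where
  "coord2 i j = tensor_lift (\<lambda>\<xi> t. tensor_lift (\<lambda>x y. ell2_nth x i * ell2_nth y j) t *\<^sub>C \<xi>)"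

lemma ell2_nth_add: "ell2_nth (x + y) i = ell2_nth x i + ell2_nth y i"
  by transfer simp

lemma ell2_nth_scaleC: "ell2_nth (c *\<^sub>C x) i = c * ell2_nth x i"
  by transfer simp

lemma ell2_nth_unit_vec: "ell2_nth (unit_vec k) i = (if i = k then 1 else 0)"
  by transfer simp

lemma coord_bilinear_aux:
  "cbilinear (\<lambda>\<xi> x. ell2_nth x i *\<^sub>C (\<xi>::'h::complex_vector))"
  by (simp add: cbilinear_def clinear_def ell2_nth_add ell2_nth_scaleC scaleC_add_left
      scaleC_add_right scaleC_scaleC mult.commute)

lemma clinear_coord: "clinear (coord i)"
  unfolding coord_def by (rule clinear_tensor_lift [OF coord_bilinear_aux])

lemma coord_add: "coord i (u + v) = coord i u + coord i v"
  using clinear_coord unfolding clinear_def by blast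

lemma coord_tens: "coord i (\<xi> \<otimes> x) = ell2_nth x i *\<^sub>C \<xi>"
  unfolding coord_def by (rule tensor_lift_tens [OF coord_bilinear_aux])

lemma ell2_nth_mult_bilinear: "cbilinear (\<lambda>x y. ell2_nth x i * ell2_nth y j)"
  by (simp add: cbilinear_def clinear_def ell2_nth_add ell2_nth_scaleC scaleC_complex_def
      algebra_simps)

lemma coord2_bilinear_aux:
  "cbilinear (\<lambda>(\<xi>::'h::complex_vector) t.
     tensor_lift (\<lambda>x y. ell2_nth x i * ell2_nth y j) t *\<^sub>C \<xi>)"
  using clinear_tensor_lift [OF ell2_nth_mult_bilinear, of i j]
  by (simp add: cbilinear_def clinear_def scaleC_add_left scaleC_complex_def
      scaleC_add_right scaleC_scaleC mult.commute)

lemma clinear_coord2: "clinear (coord2 i j)"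
  unfolding coord2_def by (rule clinear_tensor_lift [OF coord2_bilinear_aux])

lemma coord2_tens_aux:
  "coord2 i j (\<xi> \<otimes> t) = tensor_lift (\<lambda>x y. ell2_nth x i * ell2_nth y j) t *\<^sub>C \<xi>"
  unfolding coord2_def by (rule tensor_lift_tens [OF coord2_bilinear_aux])

lemma coord2_tens: "coord2 i j (\<xi> \<otimes> (x \<otimes> y)) = (ell2_nth x i * ell2_nth y j) *\<^sub>C \<xi>"
  by (simp only: coord2_tens_aux tensor_lift_tens [OF ell2_nth_mult_bilinear])

lemma clinear_comp: "clinear f \<Longrightarrow> clinear g \<Longrightarrow> clinear (\<lambda>x. f (g x))"
  by (simp add: clinear_def)

text \<open>The operator and the coordinate functional act on different tensor factors, hence
  commute.\<close>

lemma coord_act: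
  assumes "clinear a"
  shows "coord i (act a u) = a (coord i u)"
proof (rule clinear_tensor_eqI [where u = u])
  show "clinear (\<lambda>u. coord i (act a u))" "clinear (\<lambda>u. a (coord i u))"
    by (rule clinear_comp [OF clinear_coord clinear_act [OF assms]]
        clinear_comp [OF assms clinear_coord])+
  show "coord i (act a (\<xi> \<otimes> x)) = a (coord i (\<xi> \<otimes> x))" for \<xi> x
    using assms by (simp add: act_tens coord_tens clinear_def)
qed

lemma coord2_act:
  assumes "clinear a"
  shows "coord2 i j (act a W) = a (coord2 i j W)"
proof (rule clinear_tensor_eqI [where u = W])
  show "clinear (\<lambda>W. coord2 i j (act a W))" "clinear (\<lambda>W. a (coord2 i j W))"
    by (rule clinear_comp [OF clinear_coord2 clinear_act [OF assms]]
        clinear_comp [OF assms clinear_coord2])+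
  show "coord2 i j (act a (\<xi> \<otimes> t)) = a (coord2 i j (\<xi> \<otimes> t))" for \<xi> t
    using assms by (simp add: act_tens coord2_tens_aux clinear_def)
qed

text \<open>Both sides are linear in \<open>u\<close> and in \<open>v\<close>, so two nested
  reductions leave only elementary tensors.\<close>

lemma coord2_diamond:
  fixes d :: "'h::complex_hilbert \<Rightarrow> 'h \<Rightarrow> 'h"
  assumes d: "cbilinear d"
  shows "coord2 i j (diamond d u v) = d (coord i u) (coord j v)"
proof (rule clinear_tensor_eqI [where u = u])
  have d_right: "clinear (d \<xi>)" and d_left: "clinear (\<lambda>\<xi>. d \<xi> \<eta>)" for \<xi> \<eta>
    using d by (simp_all add: cbilinear_def)
  show "clinear (\<lambda>u. coord2 i j (diamond d u v))"
    by (intro clinear_comp [OF clinear_coord2] diamond_clinear_left d)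
  show "clinear (\<lambda>u. d (coord i u) (coord j v))"
    by (rule clinear_comp [OF d_left clinear_coord])
  fix \<xi> :: 'h and x
  show "coord2 i j (diamond d (\<xi> \<otimes> x) v) = d (coord i (\<xi> \<otimes> x)) (coord j v)"
  proof (rule clinear_tensor_eqI [where u = v])
    show "clinear (\<lambda>v. coord2 i j (diamond d (\<xi> \<otimes> x) v))"
      by (intro clinear_comp [OF clinear_coord2] diamond_clinear_right d)
    show "clinear (\<lambda>v. d (coord i (\<xi> \<otimes> x)) (coord j v))"
      by (rule clinear_comp [OF d_right clinear_coord])
    show "coord2 i j (diamond d (\<xi> \<otimes> x) (\<eta> \<otimes> y)) = d (coord i (\<xi> \<otimes> x)) (coord j (\<eta> \<otimes> y))"
      for \<eta> y
      using d_right d_left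
      by (simp add: diamond_tens [OF d] coord2_tens coord_tens clinear_def scaleC_scaleC
          mult.commute)
  qed
qed

section \<open>The Hilbert tensor norm in coordinates\<close>

lemma hil_cinner_add_left: "hil_cinner (u + v) w = hil_cinner u w + hil_cinner v w"
  using hil_cinner_clinear_left unfolding clinear_def by blast

lemma hil_cinner_add_right: "hil_cinner u (v + w) = hil_cinner u v + hil_cinner u w"
proof (induction u rule: tensor_induct)
  case (tens x y)
  show ?case
    unfolding hil_cinner_def tensor_lift_tens [OF hil_cinner_bilinear_aux2]
    using clinear_tensor_lift [OF hil_cinner_bilinear_aux, of x y] by (simp add: clinear_def)
next
  case (add u u')
  then show ?case by (simp add: hil_cinner_add_left)
qed

text \<open>Parseval in the second factor. Stating it with \<open>sums\<close> carries convergence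
  along, so both inductions close by adding series.\<close>

lemma hil_cinner_coord_sums:
  fixes u v :: "('h::complex_inner, ell2) tensor"
  shows "(\<lambda>i. cinner (coord i u) (coord i v)) sums hil_cinner u v"
proof (induction u rule: tensor_induct)
  case (tens \<xi> x)
  show ?case
  proof (induction v rule: tensor_induct)
    case (tens \<eta> y)
    have "(\<lambda>i. ell2_nth x i * cnj (ell2_nth y i)) sums cinner x y"
      unfolding cinner_ell2_def
      by (intro summable_sums ell2_summable_prod ell2_summable)
    from sums_mult [OF this, of "cinner \<xi> \<eta>"] show ?case
      by (simp add: coord_tens hil_cinner_tens cinner_scaleC_left cinner_scaleC_right mult_ac)
  next
    case (add v w)
    from sums_add [OF this] show ?case
      by (simp add: coord_add hil_cinner_add_right cinner_add_right)
  qed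
next
  case (add u w)
  from sums_add [OF this] show ?case
    by (simp add: coord_add hil_cinner_add_left cinner_add_left)
qed

lemma sum_norm_coord_sq_le:
  "(\<Sum>i<n. (norm (coord i u))\<^sup>2) \<le> (hil_norm u)\<^sup>2"
proof -
  have s: "(\<lambda>i. (norm (coord i u))\<^sup>2) sums Re (hil_cinner u u)"
    using sums_Re [OF hil_cinner_coord_sums [of u u]] by (simp only: norm_sq_eq_Re_cinner)
  \<comment> \<open>Positivity is what lets the square cancel the root in
    \<open>hil_norm\<close>.\<close>
  have "0 \<le> Re (hil_cinner u u)"
    using s by (rule sums_le [OF _ sums_zero, rotated]) simp
  moreover have "(\<Sum>i<n. (norm (coord i u))\<^sup>2) \<le> Re (hil_cinner u u)"
    using sum_le_suminf [OF sums_summable [OF s], of "{..<n}"] sums_unique [OF s] by simp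
  ultimately show ?thesis by (simp add: hil_norm_def)
qed

section \<open>The lower estimate\<close>

lemma orthogonal_supports_coord:
  assumes "support P u" "support Q v" "P \<circ> Q = (\<lambda>_. 0)"
  shows "cinner (coord i u) (coord j v) = 0"
proof -
  have "clinear P" "clinear Q" "\<And>x y. cinner (P x) y = cinner x (P y)"
    using assms by (simp_all add: support_def projection_def bounded_clinear_def)
  moreover have "act P u = u" "act Q v = v"
    using assms by (simp_all add: support_def)
  \<comment> \<open>Coordinates inherit the supports, so the product is
    \<open>cinner (P x) (Q y) = cinner x (P (Q y)) = 0\<close>, with \<open>x\<close> and
    \<open>y\<close> the two coordinates.\<close>
  ultimately show ?thesis
    using assms(3) by (metis cinner_zero_right coord_act comp_apply)
qed

text \<open>Truncating both indices at \<open>n\<close> keeps every sum finite, so reordering raises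
  no question of convergence.\<close>

lemma sum_norm_coord2_sq_le:
  fixes d :: "'h::complex_hilbert \<Rightarrow> 'h \<Rightarrow> 'h"
  assumes d: "cbilinear d"
    and d_cinner: "\<And>\<xi> \<eta> \<xi>' \<eta>'. cinner (d \<xi> \<eta>) (d \<xi>' \<eta>') = cinner \<xi> \<xi>' * cinner \<eta> \<eta>'"
    and a: "bounded_clinear a" and sup: "pairwise_orthogonal_supports m u"
  shows "(\<Sum>i<n. \<Sum>j<n. (norm (coord2 i j (act a (\<Sum>k<m. diamond d (u k) (v k)))))\<^sup>2)
      \<le> (onorm a)\<^sup>2 * (\<Sum>k<m. (hil_norm (u k))\<^sup>2 * (hil_norm (v k))\<^sup>2)"
proof -
  have lin: "clinear a" and bdd: "bounded_linear a"
    using a by (simp_all add: bounded_clinear_def)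
  have norm_d: "(norm (d \<xi> \<eta>))\<^sup>2 = (norm \<xi>)\<^sup>2 * (norm \<eta>)\<^sup>2" for \<xi> \<eta>
    unfolding norm_sq_eq_Re_cinner [of "d \<xi> \<eta>"] d_cinner
    by (simp add: cinner_self del: of_real_power)
  \<comment> \<open>By \<open>d_cinner\<close>, orthogonality in the left argument of
    \<open>d\<close> already makes the summands of each coordinate of \<open>U\<close>
    orthogonal.\<close>
  have orth: "cinner (coord i (u k)) (coord i (u l)) = 0" if "k < m" "l < m" "k \<noteq> l" for i k l
    using sup that unfolding pairwise_orthogonal_supports_def
    by (blast intro: orthogonal_supports_coord)
  define U where "U = (\<Sum>k<m. diamond d (u k) (v k))"
  have U: "(norm (coord2 i j U))\<^sup>2 = (\<Sum>k<m. (norm (coord i (u k)))\<^sup>2 * (norm (coord j (v k)))\<^sup>2)" for i j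
  proof -
    have UU: "coord2 i j U = (\<Sum>k<m. d (coord i (u k)) (coord j (v k)))"
      unfolding U_def by (simp add: clinear_sum [OF clinear_coord2] coord2_diamond [OF d])
    show ?thesis
      by (subst UU, subst norm_sq_sum_orthogonal)
        (simp_all add: d_cinner orth norm_d)
  qed
  have "(\<Sum>i<n. \<Sum>j<n. (norm (coord2 i j (act a U)))\<^sup>2)
      \<le> (\<Sum>i<n. \<Sum>j<n. (onorm a)\<^sup>2 * (norm (coord2 i j U))\<^sup>2)"
    unfolding coord2_act [OF lin] power_mult_distrib [symmetric]
    by (intro sum_mono power_mono onorm bdd) simp
  also have "\<dots> = (onorm a)\<^sup>2 * (\<Sum>i<n. \<Sum>j<n. \<Sum>k<m.
      (norm (coord i (u k)))\<^sup>2 * (norm (coord j (v k)))\<^sup>2)"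
    by (simp only: U sum_distrib_left)
  \<comment> \<open>Moving \<open>k\<close> outermost lets the sums over \<open>i\<close> and
    \<open>j\<close> factor, each then being bounded by a squared Hilbert norm.\<close>
  also have "(\<Sum>i<n. \<Sum>j<n. \<Sum>k<m. (norm (coord i (u k)))\<^sup>2 * (norm (coord j (v k)))\<^sup>2)
      = (\<Sum>i<n. \<Sum>k<m. \<Sum>j<n. (norm (coord i (u k)))\<^sup>2 * (norm (coord j (v k)))\<^sup>2)"
    by (intro sum.cong refl sum.swap)
  also have "\<dots> = (\<Sum>k<m. \<Sum>i<n. \<Sum>j<n. (norm (coord i (u k)))\<^sup>2 * (norm (coord j (v k)))\<^sup>2)"
    by (rule sum.swap)
  also have "\<dots> = (\<Sum>k<m. (\<Sum>i<n. (norm (coord i (u k)))\<^sup>2) * (\<Sum>j<n. (norm (coord j (v k)))\<^sup>2))"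
    by (simp only: sum_product)
  also have "(onorm a)\<^sup>2 * \<dots> \<le> (onorm a)\<^sup>2 * (\<Sum>k<m. (hil_norm (u k))\<^sup>2 * (hil_norm (v k))\<^sup>2)"
    by (intro mult_left_mono sum_mono mult_mono sum_norm_coord_sq_le sum_nonneg) auto
  finally show ?thesis by (simp only: U_def)
qed

section \<open>Norms of elementary tensors and the norm of \<open>V\<close>\<close>

lemma hil_norm_tens: "hil_norm (x \<otimes> y) = norm x * norm y"
proof -
  have "hil_norm (x \<otimes> y) = sqrt ((norm x * norm y)\<^sup>2)"
    unfolding hil_norm_def by (simp add: hil_cinner_tens cinner_self power_mult_distrib)
  then show ?thesis by simp
qed

lemma norm_unit_vec: "norm (unit_vec k) = 1"
proof -
  have "(\<lambda>i. (cmod (ell2_nth (unit_vec k) i))\<^sup>2) = (\<lambda>i. if i = k then 1 else 0)"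
    by (auto simp: ell2_nth_unit_vec)
  then show ?thesis
    using sums_unique [OF sums_single [of k "\<lambda>_. 1::real"]] by (simp add: norm_ell2_def)
qed

theorem proposition8p3:
  fixes j :: "('h::complex_hilbert, 'h) tensor \<Rightarrow> 'k::complex_hilbert"
    and \<iota> :: "'k \<Rightarrow> 'h"
    and e :: "nat \<Rightarrow> 'h"
    and n :: nat
    and V :: "('h, (ell2, ell2) tensor) tensor"
  assumes "separable TYPE('h)"
    and "infinite_dimensional TYPE('h)"
    and "hilbert_completion j"
    and "unitary \<iota>"
    and "orthonormal_seq e"
    and "V = (\<Sum>k<n. e k \<otimes> (unit_vec k \<otimes> unit_vec k))"
  shows "l_norm (\<lambda>\<xi> \<eta>. \<iota> (j (\<xi> \<otimes> \<eta>))) hil_norm hil_norm V = sqrt (real n)"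
proof -
  define d where "d \<xi> \<eta> = \<iota> (j (\<xi> \<otimes> \<eta>))" for \<xi> \<eta>
  have "clinear (\<lambda>w. \<iota> (j w))"
    using assms(3,4) by (simp add: hilbert_completion_def unitary_def clinear_comp)
  then have d: "cbilinear d"
    by (simp add: cbilinear_def clinear_def d_def tens_add_left tens_add_right
        tens_scaleC_left tens_scaleC_right)
  have d_cinner: "cinner (d \<xi> \<eta>) (d \<xi>' \<eta>') = cinner \<xi> \<xi>' * cinner \<eta> \<eta>'" for \<xi> \<eta> \<xi>' \<eta>'
    using assms(3,4) by (simp add: d_def unitary_def hilbert_completion_def hil_cinner_tens)
  have e: "cinner (e k) (e l) = (if k = l then 1 else 0)" for k l
    using assms(5) by (simp add: orthonormal_seq_def)
  note norm_e = orthonormal_seq_norm [OF assms(5)]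
  let ?S = "{onorm a * sqrt (\<Sum>k<m. (hil_norm (u k))\<^sup>2 * (hil_norm (v k))\<^sup>2) | m a u v.
     bounded_clinear a \<and> pairwise_orthogonal_supports m u \<and>
     V = act a (\<Sum>k<m. diamond d (u k) (v k))}"
  have V_coord: "(\<Sum>i<n. \<Sum>j<n. (norm (coord2 i j V))\<^sup>2) = real n"
  proof -
    have "coord2 i j V = (if i = j then e i else 0)" if "i < n" for i j
    proof -
      \<comment> \<open>Only the summand \<open>k = i\<close> has a nonzero \<open>i\<close>-th
        entry; it occurs because \<open>i < n\<close>, and its \<open>j\<close>-th entry vanishes
        off the diagonal.\<close>
      have "coord2 i j V = (\<Sum>k<n. if k = i then (if i = j then e i else 0) else 0)"
        unfolding assms(6) clinear_sum [OF clinear_coord2] coord2_tens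
        by (intro sum.cong) (auto simp: ell2_nth_unit_vec scaleC_one)
      then show ?thesis using that by simp
    qed
    then have "(\<Sum>i<n. \<Sum>j<n. (norm (coord2 i j V))\<^sup>2) = (\<Sum>i<n. \<Sum>j<n. if i = j then 1 else 0)"
      by (intro sum.cong refl) (simp add: norm_e)
    then show ?thesis by simp
  qed
  have lower: "sqrt (real n) \<le> s" if "s \<in> ?S" for s
  proof -
    from that obtain m a u v where
      s: "s = onorm a * sqrt (\<Sum>k<m. (hil_norm (u k))\<^sup>2 * (hil_norm (v k))\<^sup>2)"
      and a: "bounded_clinear a" and u: "pairwise_orthogonal_supports m u"
      and V: "V = act a (\<Sum>k<m. diamond d (u k) (v k))"
      by blast
    have le: "real n \<le> (onorm a)\<^sup>2 * (\<Sum>k<m. (hil_norm (u k))\<^sup>2 * (hil_norm (v k))\<^sup>2)"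
      using sum_norm_coord2_sq_le [OF d d_cinner a u, where n = n and v = v] V_coord by (simp only: V)
    have "0 \<le> onorm a"
      using a by (simp add: bounded_clinear_def onorm_pos_le)
    with real_sqrt_le_mono [OF le] show ?thesis
      by (simp add: s real_sqrt_mult)
  qed
  \<comment> \<open>One such member suffices: \<open>lower\<close> forces it to equal
    \<open>sqrt (real n)\<close>, so the infimum is attained.\<close>
  have "\<exists>s\<in>?S. s \<le> sqrt (real n)"
  proof -
    \<comment> \<open>\<open>e 0\<close> is merely a fixed unit vector: pairing with it preserves
      the inner products of the \<open>e k\<close>.\<close>
    have "orthonormal_seq (\<lambda>k. d (e k) (e 0))"
      by (simp add: orthonormal_seq_def d_cinner e)
    then obtain a where a: "bounded_clinear a" "onorm a \<le> 1"
      and ad: "\<And>k. k < n \<Longrightarrow> a (d (e k) (e 0)) = e k"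
      using orthonormal_seq_partial_isometry [OF assms(5)] by blast
    have lin: "clinear a" using a by (simp add: bounded_clinear_def)
    define u v where "u k = e k \<otimes> unit_vec k" and "v k = e 0 \<otimes> unit_vec k" for k
    let ?s = "onorm a * sqrt (\<Sum>k<n. (hil_norm (u k))\<^sup>2 * (hil_norm (v k))\<^sup>2)"
    have "pairwise_orthogonal_supports n u"
      unfolding pairwise_orthogonal_supports_def
    proof (intro exI conjI allI impI)
      let ?P = "\<lambda>k x. cinner x (e k) *\<^sub>C e k"
      show "support (?P k) (u k)" for k
        using projection_rank_one [OF norm_e, of k]
        by (simp add: support_def u_def act_tens projection_def bounded_clinear_def e scaleC_one)
      show "?P k \<circ> ?P l = (\<lambda>_. 0)" if "k \<noteq> l" for k l
        using that by (simp add: fun_eq_iff cinner_scaleC_left e)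
    qed
    moreover have "V = act a (\<Sum>k<n. diamond d (u k) (v k))"
      by (simp add: assms(6) u_def v_def diamond_tens [OF d] clinear_sum [OF clinear_act [OF lin]]
          act_tens [OF lin] ad)
    ultimately have "?s \<in> ?S" using a(1) by blast
    \<comment> \<open>All \<open>u k\<close> and \<open>v k\<close> have norm 1, so the root in
      \<open>?s\<close> is \<open>sqrt (real n)\<close>, and \<open>a\<close> is a
      contraction.\<close>
    moreover have "?s \<le> sqrt (real n)"
      using mult_right_mono [OF a(2), of "sqrt (real n)"]
      by (simp add: u_def v_def hil_norm_tens norm_e norm_unit_vec)
    ultimately show ?thesis by (rule rev_bexI)
  qed
  then obtain s where s: "s \<in> ?S" "s \<le> sqrt (real n)"
    by (rule bexE)
  have "sqrt (real n) = s"
    by (rule order_antisym [OF lower [OF s(1)] s(2)])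
  then have "sqrt (real n) \<in> ?S"
    using s(1) by (rule ssubst)
  then have "Inf ?S = sqrt (real n)"
    using lower by (rule cInf_eq_minimum)
  then show ?thesis by (simp only: l_norm_def d_def [abs_def])
qed

end
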